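(* If spaces $X$ and $Y$ have the same homotopy type, then $N_*\mathcal{E}(X)=N_*\mathcal{E}(Y)$ and $N^*\mathcal{E}(X)=N^*\mathcal{E}(Y)$.
   Context: Spaces, maps and homotopies are based; $[X,X]$ is the set of based homotopy classes of self-maps of $X$, and $\mathcal{E}(X)\subset [X,X]$ is the set of homotopy classes of self-homotopy equivalences. With integral (co)homology, let $\mathcal{A}_*^k(X)=\{f\in[X,X] : f_*:H_i(X)\to H_i(X)\text{ is an isomorphism for all } i\le k\}$ and $\mathcal{A}^*_k(X)=\{f\in[X,X] : f^*:H^i(X)\to H^i(X)\text{ is an isomorphism for all } i\le k\}$. The homology and cohomology self-closeness numbers are $N_*\mathcal{E}(X)=\min\{k:\mathcal{A}_*^k(X)=\mathcal{E}(X)\}$ and $N^*\mathcal{E}(X)=\min\{k:\mathcal{A}^*_k(X)=\mathcal{E}(X)\}$, where $k$ ranges over $0,1,2,\dots,\infty$; if no such $k$ exists, the number is assigned the symbolic value $\emptyset$ (undefined). No connectivity of $X$ is assumed in these definitions. *)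

theory Defs
  imports "HOL-Homology.Homology" "HOL-Library.Extended_Nat"
begin

section \<open>Based maps and based homotopy\<close>

definition based_map :: "'a topology \<Rightarrow> 'a \<Rightarrow> 'b topology \<Rightarrow> 'b \<Rightarrow> ('a \<Rightarrow> 'b) \<Rightarrow> bool" where
  "based_map X x Y y f \<longleftrightarrow> continuous_map X Y f \<and> f x = y"

definition based_homotopic ::
    "'a topology \<Rightarrow> 'a \<Rightarrow> 'b topology \<Rightarrow> 'b \<Rightarrow> ('a \<Rightarrow> 'b) \<Rightarrow> ('a \<Rightarrow> 'b) \<Rightarrow> bool" where
  "based_homotopic X x Y y = homotopic_with (\<lambda>h. h x = y) X Y"

text \<open>Based homotopic maps are automatically based maps. Functions that agree on the
  underlying space of \<open>X\<close> are homotopic, so the values outside it do not affect the class.\<close>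

definition based_class ::
    "'a topology \<Rightarrow> 'a \<Rightarrow> 'b topology \<Rightarrow> 'b \<Rightarrow> ('a \<Rightarrow> 'b) \<Rightarrow> ('a \<Rightarrow> 'b) set" where
  "based_class X x Y y f = {g. based_homotopic X x Y y f g}"

definition based_homotopy_equivalence ::
    "'a topology \<Rightarrow> 'a \<Rightarrow> 'b topology \<Rightarrow> 'b \<Rightarrow> ('a \<Rightarrow> 'b) \<Rightarrow> bool" where
  "based_homotopy_equivalence X x Y y f \<longleftrightarrow>
     based_map X x Y y f \<and>
     (\<exists>g. based_map Y y X x g \<and>
          based_homotopic X x X x (g \<circ> f) id \<and> based_homotopic Y y Y y (f \<circ> g) id)"

definition same_based_homotopy_type ::
    "'a topology \<Rightarrow> 'a \<Rightarrow> 'b topology \<Rightarrow> 'b \<Rightarrow> bool" where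
  "same_based_homotopy_type X x Y y \<longleftrightarrow> (\<exists>f. based_homotopy_equivalence X x Y y f)"

definition self_equivalences :: "'a topology \<Rightarrow> 'a \<Rightarrow> ('a \<Rightarrow> 'a) set set" where
  "self_equivalences X x = based_class X x X x ` {f. based_homotopy_equivalence X x X x f}"


section \<open>Integral singular cohomology\<close>

text \<open>Cochains are homomorphisms from the singular chain group to the integers; extensionality
  makes the function that represents such a homomorphism unique.\<close>

definition cochain_group :: "nat \<Rightarrow> 'a topology \<Rightarrow> ('a chain \<Rightarrow> int) monoid" where
  "cochain_group p X =
     \<lparr>carrier = hom (chain_group p X) integer_group \<inter> extensional (carrier (chain_group p X)),
      monoid.mult = (\<lambda>a b. \<lambda>c\<in>carrier (chain_group p X). a c + b c),
      one = (\<lambda>c\<in>carrier (chain_group p X). 0)\<rparr>"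

definition coboundary :: "nat \<Rightarrow> 'a topology \<Rightarrow> ('a chain \<Rightarrow> int) \<Rightarrow> 'a chain \<Rightarrow> int" where
  "coboundary p X a = (\<lambda>c\<in>carrier (chain_group (Suc p) X). a (chain_boundary (Suc p) c))"

definition cocycle_set :: "nat \<Rightarrow> 'a topology \<Rightarrow> ('a chain \<Rightarrow> int) set" where
  "cocycle_set p X = kernel (cochain_group p X) (cochain_group (Suc p) X) (coboundary p X)"

definition coboundary_set :: "nat \<Rightarrow> 'a topology \<Rightarrow> ('a chain \<Rightarrow> int) set" where
  "coboundary_set p X =
     (case p of 0 \<Rightarrow> {\<one>\<^bsub>cochain_group 0 X\<^esub>}
      | Suc q \<Rightarrow> coboundary q X ` carrier (cochain_group q X))"

definition cocycle_group :: "nat \<Rightarrow> 'a topology \<Rightarrow> ('a chain \<Rightarrow> int) monoid" where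
  "cocycle_group p X = subgroup_generated (cochain_group p X) (cocycle_set p X)"

definition cohomology_group :: "nat \<Rightarrow> 'a topology \<Rightarrow> ('a chain \<Rightarrow> int) set monoid" where
  "cohomology_group p X = cocycle_group p X Mod coboundary_set p X"

definition cochain_map ::
    "nat \<Rightarrow> 'a topology \<Rightarrow> ('a \<Rightarrow> 'b) \<Rightarrow> ('b chain \<Rightarrow> int) \<Rightarrow> 'a chain \<Rightarrow> int" where
  "cochain_map p X f b = (\<lambda>c\<in>carrier (chain_group p X). b (chain_map p f c))"

text \<open>The union is over the cosets of the pullbacks of all representatives of \<open>K\<close>. For
  continuous \<open>f\<close> these cosets coincide; see \<open>cohom_induced_coset\<close> below.\<close>

definition cohom_induced ::
    "nat \<Rightarrow> 'a topology \<Rightarrow> 'b topology \<Rightarrow> ('a \<Rightarrow> 'b)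
       \<Rightarrow> ('b chain \<Rightarrow> int) set \<Rightarrow> ('a chain \<Rightarrow> int) set" where
  "cohom_induced p X Y f =
     (\<lambda>K\<in>carrier (cohomology_group p Y).
        \<Union>b\<in>K. coboundary_set p X #>\<^bsub>cocycle_group p X\<^esub> cochain_map p X f b)"


subsection \<open>Cohomology groups and induced maps are well defined\<close>

lemma carrier_cochain_group:
  "a \<in> carrier (cochain_group p X) \<longleftrightarrow>
     (\<forall>c d. singular_chain p X c \<longrightarrow> singular_chain p X d \<longrightarrow> a (c + d) = a c + a d) \<and>
     a \<in> extensional (singular_chain_set p X)"
  by (auto simp: cochain_group_def hom_def)

lemma mult_cochain_group:
  "a \<otimes>\<^bsub>cochain_group p X\<^esub> b = (\<lambda>c\<in>singular_chain_set p X. a c + b c)"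
  by (simp add: cochain_group_def)

lemma one_cochain_group: "\<one>\<^bsub>cochain_group p X\<^esub> = (\<lambda>c\<in>singular_chain_set p X. 0)"
  by (simp add: cochain_group_def)

lemma comm_group_cochain_group: "comm_group (cochain_group p X)"
proof (rule comm_groupI)
  fix a assume a: "a \<in> carrier (cochain_group p X)"
  show "\<exists>b\<in>carrier (cochain_group p X). b \<otimes>\<^bsub>cochain_group p X\<^esub> a = \<one>\<^bsub>cochain_group p X\<^esub>"
    using a by (intro bexI[of _ "\<lambda>c\<in>singular_chain_set p X. - a c"])
      (auto simp: carrier_cochain_group mult_cochain_group one_cochain_group singular_chain_add)
  show "\<one>\<^bsub>cochain_group p X\<^esub> \<otimes>\<^bsub>cochain_group p X\<^esub> a = a"
    using a
    by (auto simp: carrier_cochain_group mult_cochain_group one_cochain_group extensional_def)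
qed (auto simp: carrier_cochain_group mult_cochain_group one_cochain_group singular_chain_add
      add_ac intro!: restrict_ext)

lemma group_cochain_group: "group (cochain_group p X)"
  using comm_group_cochain_group comm_group.axioms(2) by blast

lemma coboundary_hom:
  "coboundary p X \<in> hom (cochain_group p X) (cochain_group (Suc p) X)"
  using singular_chain_boundary[of "Suc p" X]
  by (auto simp: hom_def carrier_cochain_group mult_cochain_group coboundary_def
      singular_chain_add chain_boundary_add intro!: restrict_ext)

lemma cochain_map_hom:
  assumes "continuous_map X Y f"
  shows "cochain_map p X f \<in> hom (cochain_group p Y) (cochain_group p X)"
  using singular_chain_chain_map[OF _ assms]
  by (auto simp: hom_def carrier_cochain_group mult_cochain_group cochain_map_def
      singular_chain_add chain_map_add intro!: restrict_ext)

lemma coboundary_cochain_map: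
  assumes "continuous_map X Y f"
  shows "coboundary p X (cochain_map p X f b) = cochain_map (Suc p) X f (coboundary p Y b)"
  using singular_chain_boundary[of "Suc p" X] singular_chain_chain_map[OF _ assms]
  by (auto simp: coboundary_def cochain_map_def chain_boundary_chain_map intro!: restrict_ext)

lemma subgroup_cocycle_set: "subgroup (cocycle_set p X) (cochain_group p X)"
  unfolding cocycle_set_def
  by (intro group_hom.subgroup_kernel)
     (simp add: group_hom_def group_hom_axioms_def group_cochain_group coboundary_hom)

lemma carrier_cocycle_group: "carrier (cocycle_group p X) = cocycle_set p X"
  by (simp add: cocycle_group_def subgroup.carrier_subgroup_generated_subgroup
      group_cochain_group subgroup_cocycle_set)

lemma comm_group_cocycle_group: "comm_group (cocycle_group p X)"
  by (simp add: cocycle_group_def group.abelian_subgroup_generated group_cochain_group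
      comm_group_cochain_group)

lemma coboundary_hom_cocycle:
  "coboundary p X \<in> hom (cochain_group p X) (cocycle_group (Suc p) X)"
proof -
  have "coboundary p X a \<in> cocycle_set (Suc p) X" if "a \<in> carrier (cochain_group p X)" for a
  proof -
    have "a 0 = 0"
      using that singular_chain_0[of p X] by (metis add_cancel_left_left add_0 carrier_cochain_group)
    then have "coboundary (Suc p) X (coboundary p X a) = \<one>\<^bsub>cochain_group (Suc (Suc p)) X\<^esub>"
      using singular_chain_boundary[of "Suc (Suc p)" X] chain_boundary_boundary[of "Suc (Suc p)" X]
      by (auto simp: coboundary_def one_cochain_group intro!: restrict_ext)
    moreover have "coboundary p X a \<in> carrier (cochain_group (Suc p) X)"
      using that coboundary_hom hom_in_carrier by metis
    ultimately show ?thesis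
      by (simp add: cocycle_set_def kernel_def)
  qed
  then show ?thesis
    using coboundary_hom[of p X] by (auto simp: hom_def carrier_cocycle_group) (auto simp: cocycle_group_def)
qed

lemma subgroup_coboundary_set: "subgroup (coboundary_set p X) (cocycle_group p X)"
proof (cases p)
  case 0
  then show ?thesis
    using group.triv_subgroup[OF comm_group.axioms(2)[OF comm_group_cocycle_group[of 0 X]]]
    by (simp add: coboundary_set_def cocycle_group_def)
next
  case (Suc q)
  interpret group_hom "cochain_group q X" "cocycle_group (Suc q) X" "coboundary q X"
    using coboundary_hom_cocycle[of q X] comm_group_cocycle_group[of "Suc q" X]
    by (simp add: group_hom_def group_hom_axioms_def group_cochain_group comm_group.axioms(2))
  show ?thesis
    using img_is_subgroup by (simp add: Suc coboundary_set_def)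
qed

lemma comm_group_cohomology_group: "comm_group (cohomology_group p X)"
  unfolding cohomology_group_def
  using comm_group.abelian_FactGroup[OF comm_group_cocycle_group subgroup_coboundary_set] .

lemma cochain_map_cocycle:
  assumes "continuous_map X Y f"
  shows "cochain_map p X f \<in> hom (cocycle_group p Y) (cocycle_group p X)"
proof -
  have "cochain_map p X f b \<in> cocycle_set p X" if "b \<in> cocycle_set p Y" for b
    using that cochain_map_hom[OF assms, of p] singular_chain_chain_map[OF _ assms]
    by (auto simp: cocycle_set_def kernel_def coboundary_cochain_map[OF assms] hom_in_carrier)
       (auto simp: cochain_map_def one_cochain_group intro!: restrict_ext)
  moreover have "cocycle_set p Y \<subseteq> carrier (cochain_group p Y)"
    by (auto simp: cocycle_set_def kernel_def)
  ultimately show ?thesis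
    using cochain_map_hom[OF assms, of p]
    by (auto simp: hom_def carrier_cocycle_group) (auto simp: cocycle_group_def subset_iff)
qed

lemma cochain_map_coboundary_set:
  assumes "continuous_map X Y f" "b \<in> coboundary_set p Y"
  shows "cochain_map p X f b \<in> coboundary_set p X"
proof (cases p)
  case 0
  then show ?thesis
    using assms singular_chain_chain_map[OF _ assms(1)]
    by (auto simp: coboundary_set_def cochain_map_def one_cochain_group intro!: restrict_ext)
next
  case (Suc q)
  then obtain a where a: "a \<in> carrier (cochain_group q Y)" "b = coboundary q Y a"
    using assms(2) by (auto simp: coboundary_set_def)
  have "cochain_map p X f b = coboundary q X (cochain_map q X f a)"
    using a(2) Suc coboundary_cochain_map[OF assms(1)] by metis
  then show ?thesis
    using hom_in_carrier[OF cochain_map_hom[OF assms(1)] a(1)] by (simp add: Suc coboundary_set_def)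
qed

lemma cohom_induced_coset:
  assumes f: "continuous_map X Y f" and b: "b \<in> carrier (cocycle_group p Y)"
  shows "cohom_induced p X Y f (coboundary_set p Y #>\<^bsub>cocycle_group p Y\<^esub> b)
           = coboundary_set p X #>\<^bsub>cocycle_group p X\<^esub> cochain_map p X f b"
proof -
  let ?X = "cocycle_group p X" and ?Y = "cocycle_group p Y"
  let ?BX = "coboundary_set p X" and ?BY = "coboundary_set p Y"
  interpret X: comm_group ?X by (rule comm_group_cocycle_group)
  interpret Y: comm_group ?Y by (rule comm_group_cocycle_group)
  note hom = cochain_map_cocycle[OF f, of p]
  have sub: "?BX \<subseteq> carrier ?X" "?BY \<subseteq> carrier ?Y"
    using subgroup_coboundary_set subgroup.subset by blast+
  have eq: "?BX #>\<^bsub>?X\<^esub> cochain_map p X f b' = ?BX #>\<^bsub>?X\<^esub> cochain_map p X f b"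
    if b': "b' \<in> ?BY #>\<^bsub>?Y\<^esub> b" for b'
  proof -
    obtain h where h: "h \<in> ?BY" "b' = h \<otimes>\<^bsub>?Y\<^esub> b"
      using b' by (auto simp: r_coset_def)
    have "cochain_map p X f b' = cochain_map p X f h \<otimes>\<^bsub>?X\<^esub> cochain_map p X f b"
      using h b sub hom_mult[OF hom] by blast
    then have "cochain_map p X f b' \<in> ?BX #>\<^bsub>?X\<^esub> cochain_map p X f b"
      using cochain_map_coboundary_set[OF f h(1)] by (auto simp: r_coset_def)
    then show ?thesis
      using X.repr_independence[OF _ _ subgroup_coboundary_set] hom_in_carrier[OF hom b] by metis
  qed
  have mem: "b \<in> ?BY #>\<^bsub>?Y\<^esub> b"
    using Y.rcos_self[OF b subgroup_coboundary_set] .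
  have "?BY #>\<^bsub>?Y\<^esub> b \<in> carrier (cohomology_group p Y)"
    using b by (auto simp: cohomology_group_def carrier_FactGroup)
  then have "cohom_induced p X Y f (?BY #>\<^bsub>?Y\<^esub> b)
      = (\<Union>b'\<in>?BY #>\<^bsub>?Y\<^esub> b. ?BX #>\<^bsub>?X\<^esub> cochain_map p X f b')"
    by (simp only: cohom_induced_def restrict_apply' if_True)
  also have "\<dots> = ?BX #>\<^bsub>?X\<^esub> cochain_map p X f b"
    using UN_constant_eq[OF mem ballI[OF eq]] .
  finally show ?thesis .
qed


section \<open>Self-closeness numbers\<close>

definition homology_iso_classes :: "enat \<Rightarrow> 'a topology \<Rightarrow> 'a \<Rightarrow> ('a \<Rightarrow> 'a) set set" where
  "homology_iso_classes k X x = based_class X x X x `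
     {f. based_map X x X x f \<and>
         (\<forall>i. enat i \<le> k \<longrightarrow>
            hom_induced (int i) X {} X {} f \<in> iso (homology_group (int i) X) (homology_group (int i) X))}"

definition cohomology_iso_classes :: "enat \<Rightarrow> 'a topology \<Rightarrow> 'a \<Rightarrow> ('a \<Rightarrow> 'a) set set" where
  "cohomology_iso_classes k X x = based_class X x X x `
     {f. based_map X x X x f \<and>
         (\<forall>i. enat i \<le> k \<longrightarrow>
            cohom_induced i X X f \<in> iso (cohomology_group i X) (cohomology_group i X))}"

text \<open>The value \<open>None\<close> stands for an undefined number, \<open>Some \<infinity>\<close> for the number infinity.\<close>

definition least_enat :: "(enat \<Rightarrow> bool) \<Rightarrow> enat option" where
  "least_enat P = (if \<exists>k. P k then Some (LEAST k. P k) else None)"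

definition homology_self_closeness :: "'a topology \<Rightarrow> 'a \<Rightarrow> enat option" where
  "homology_self_closeness X x =
     least_enat (\<lambda>k. homology_iso_classes k X x = self_equivalences X x)"

definition cohomology_self_closeness :: "'a topology \<Rightarrow> 'a \<Rightarrow> enat option" where
  "cohomology_self_closeness X x =
     least_enat (\<lambda>k. cohomology_iso_classes k X x = self_equivalences X x)"

end

theory Submission
  imports Defs
begin

text \<open>For mutually inverse equivalences \<open>\<phi> : X \<rightarrow> Y\<close> and \<open>\<psi> : Y \<rightarrow> X\<close>, the conjugations
  \<open>f \<mapsto> \<phi> f \<psi>\<close> and \<open>g \<mapsto> \<psi> g \<phi>\<close> are mutually inverse on homotopy classes of self-maps. They
  preserve self-equivalences, and also self-maps that induce isomorphisms in a given degree, because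
  \<open>\<phi>\<close> and \<open>\<psi>\<close> induce isomorphisms themselves. In cohomology this needs an additive chain homotopy
  between homotopic maps, defined on all chains and not only on cycles. It is constructed with acyclic
  models: in the contractible cylinders on the standard simplices, the required cycles bound.\<close>

section \<open>Acyclicity of the models\<close>

text \<open>A contraction makes \<open>c\<close> homologous to its image at a point, and above
  degree 0 every cycle of a one-point space bounds.\<close>

lemma contractible_space_cycle_imp_boundary:
  assumes X: "contractible_space X" and p: "1 \<le> p" and c: "singular_relcycle p X {} c"
  shows "singular_relboundary p X {} c"
proof -
  obtain a where a: "homotopic_with (\<lambda>x. True) X X id (\<lambda>x. a)"
    using X by (auto simp: contractible_space_def)
  have cont: "continuous_map X X (\<lambda>x. a)"
    using homotopic_with_imp_continuous_maps[OF a] by blast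
  have chain: "singular_chain p X c"
    using c by (simp add: singular_cycle)
  have "homologous_rel p X {} (chain_map p id c) (chain_map p (\<lambda>x. a) c)"
    using homotopic_imp_homologous_rel_chain_maps[OF _ c, of "{}" X id "\<lambda>x. a"] a by simp
  then have hom: "homologous_rel p X {} c (chain_map p (\<lambda>x. a) c)"
    using chain_map_ident[OF chain] by simp
  have "singular_relboundary p X {} (chain_map p (\<lambda>x. a) c)"
  \<comment> \<open>The empty space counts as contractible, and there \<open>a\<close> need not be a
    point of the space; its only chain is 0.\<close>
  proof (cases "topspace X = {}")
    case True
    then have "c = 0"
      using chain by (simp add: singular_chain_empty)
    then show ?thesis by simp
  next
    case False
    then have "a \<in> topspace X"
      using cont by (auto simp: continuous_map_def)
    then have top: "topspace (subtopology X {a}) = {a}"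
      by auto
    have "continuous_map X (subtopology X {a}) (\<lambda>x. a)"
      using cont by (simp add: continuous_map_in_subtopology)
    then have "singular_relcycle p (subtopology X {a}) {} (chain_map p (\<lambda>x. a) c)"
      by (rule singular_relcycle_chain_map[OF c]) auto
    then have "singular_relboundary p (subtopology X {a}) {} (chain_map p (\<lambda>x. a) c)"
      using singular_boundary_eq_cycle_singleton[OF top p] by blast
    then show ?thesis
      using singular_boundary_mono[of "{a}" UNIV p X] by simp
  qed
  then show ?thesis
    using hom singular_relboundary_add unfolding homologous_rel_def by (metis diff_add_cancel)
qed

abbreviation standard_simplex_space :: "nat \<Rightarrow> (nat \<Rightarrow> real) topology" where
  "standard_simplex_space p \<equiv> subtopology (powertop_real UNIV) (standard_simplex p)"

abbreviation cylinder :: "'a topology \<Rightarrow> (real \<times> 'a) topology" where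
  "cylinder X \<equiv> prod_topology (top_of_set {0..1}) X"

text \<open>Convexity lets each point slide along a segment to the vertex \<open>v\<close>;
  continuity of \<open>h\<close> is checked coordinate by coordinate.\<close>

lemma contractible_standard_simplex_space: "contractible_space (standard_simplex_space p)"
proof -
  define v :: "nat \<Rightarrow> real" where "v = (\<lambda>j. if j = 0 then 1 else 0)"
  define h :: "real \<times> (nat \<Rightarrow> real) \<Rightarrow> nat \<Rightarrow> real"
    where "h = (\<lambda>(t, x) i. (1 - t) * x i + t * v i)"
  have v: "v \<in> standard_simplex p"
    by (simp add: v_def)
  have proj: "continuous_map (cylinder (standard_simplex_space p)) euclideanreal fst"
    using continuous_map_fst continuous_map_into_fulltopology by blast
  have coord: "continuous_map (cylinder (standard_simplex_space p)) euclideanreal (\<lambda>z. snd z i)" for i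
  proof -
    have "continuous_map (standard_simplex_space p) euclideanreal (\<lambda>x. x i)"
      by (intro continuous_map_from_subtopology continuous_map_product_projection) auto
    then show ?thesis
      using continuous_map_compose[OF continuous_map_snd] by (simp add: o_def)
  qed
  have "continuous_map (cylinder (standard_simplex_space p)) (powertop_real UNIV) h"
    unfolding h_def case_prod_unfold continuous_map_componentwise_UNIV
    by (intro allI continuous_map_add continuous_map_real_mult continuous_map_diff proj coord) auto
  moreover have "h (t, x) \<in> standard_simplex p" if "t \<in> {0..1}" "x \<in> standard_simplex p" for t x
    using convex_standard_simplex[OF that(2) v] that(1) by (simp add: h_def)
  ultimately have "continuous_map (cylinder (standard_simplex_space p)) (standard_simplex_space p) h"
    by (auto simp: continuous_map_in_subtopology)
  moreover have "h (0, x) = x" "h (1, x) = v" for x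
    by (auto simp: h_def)
  ultimately have "homotopic_with (\<lambda>x. True) (standard_simplex_space p) (standard_simplex_space p) id (\<lambda>x. v)"
    unfolding homotopic_with_def by (intro exI[of _ h]) auto
  then show ?thesis
    unfolding contractible_space_def by blast
qed

lemma contractible_cylinder: "contractible_space X \<Longrightarrow> contractible_space (cylinder X)"
  by (simp add: contractible_space_prod_topology convex_imp_contractible is_interval_1)


section \<open>A natural chain homotopy on cylinders\<close>

text \<open>The identity simplex is the universal singular simplex. It is restricted because
  singular simplices are extensional functions on the standard simplex.\<close>

definition fundamental_chain :: "nat \<Rightarrow> (nat \<Rightarrow> real) chain" where
  "fundamental_chain p = frag_of (restrict id (standard_simplex p))"

lemma singular_chain_fundamental_chain:
  "singular_chain p (standard_simplex_space p) (fundamental_chain p)"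
  unfolding fundamental_chain_def singular_chain_of
  by (rule simplicial_imp_singular_simplex) simp

text \<open>Every simplex is the image of the universal one, so natural identities need checking on
  the latter only.\<close>

lemma chain_map_fundamental_chain:
  "singular_simplex p X \<sigma> \<Longrightarrow> chain_map p \<sigma> (fundamental_chain p) = frag_of \<sigma>"
  unfolding fundamental_chain_def by (rule singular_simplex_chain_map_id)

text \<open>By naturality, a chain homotopy between the two ends of cylinders is determined by its
  values \<open>Q\<close> on the fundamental chains.\<close>

definition prism_map ::
    "nat \<Rightarrow> (real \<times> (nat \<Rightarrow> real)) chain \<Rightarrow> 'a chain \<Rightarrow> (real \<times> 'a) chain" where
  "prism_map p Q = frag_extend (\<lambda>\<sigma>. chain_map (Suc p) (map_prod id \<sigma>) Q)"

lemma prism_map_0 [simp]: "prism_map p Q 0 = 0"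
  by (simp add: prism_map_def)

lemma prism_map_of: "prism_map p Q (frag_of \<sigma>) = chain_map (Suc p) (map_prod id \<sigma>) Q"
  by (simp add: prism_map_def)

lemma prism_map_add: "prism_map p Q (c + d) = prism_map p Q c + prism_map p Q d"
  by (simp add: prism_map_def frag_extend_add)

lemma prism_map_diff: "prism_map p Q (c - d) = prism_map p Q c - prism_map p Q d"
  by (simp add: prism_map_def frag_extend_diff)

lemma continuous_map_map_prod_id:
  "continuous_map X Y f \<Longrightarrow> continuous_map (cylinder X) (cylinder Y) (map_prod id f)"
  using continuous_map_compose[OF continuous_map_snd]
  by (auto simp: map_prod_def case_prod_unfold continuous_map_pairwise o_def continuous_map_fst)

lemma continuous_map_end: "t \<in> {0..1} \<Longrightarrow> continuous_map X (cylinder X) (Pair t)"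
  by (simp add: continuous_map_pairwise o_def)

lemma singular_chain_prism_map:
  assumes Q: "singular_chain (Suc p) (cylinder (standard_simplex_space p)) Q"
    and c: "singular_chain p X c"
  shows "singular_chain (Suc p) (cylinder X) (prism_map p Q c)"
  unfolding prism_map_def
proof (rule singular_chain_extend)
  fix \<sigma> assume "\<sigma> \<in> Poly_Mapping.keys c"
  then have "continuous_map (standard_simplex_space p) X \<sigma>"
    using c by (auto simp: singular_chain_def singular_simplex_def)
  then show "singular_chain (Suc p) (cylinder X) (chain_map (Suc p) (map_prod id \<sigma>) Q)"
    using singular_chain_chain_map[OF Q] continuous_map_map_prod_id by blast
qed

text \<open>Naturality in the space, which lets equations between prisms be pushed forward from the
  standard simplex.\<close>

lemma prism_map_chain_map:
  assumes Q: "singular_chain (Suc p) (cylinder (standard_simplex_space p)) Q"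
  shows "prism_map p Q (chain_map p f c) = chain_map (Suc p) (map_prod id f) (prism_map p Q c)"
  using subset_UNIV
proof (induction c rule: frag_induction)
  case (one \<sigma>)
  \<comment> \<open>\<open>simplex_map\<close> restricts the composite to the standard simplex, so
    the two maps are only known to agree on the cylinder that carries \<open>Q\<close>.\<close>
  have "chain_map (Suc p) (map_prod id (simplex_map p f \<sigma>)) Q
      = chain_map (Suc p) (map_prod id f \<circ> map_prod id \<sigma>) Q"
    by (rule chain_map_eq[OF Q]) (auto simp: simplex_map_def)
  then show ?case
    by (simp only: chain_map_of prism_map_of chain_map_compose comp_apply)
qed (auto simp: prism_map_diff chain_map_diff)

lemma chain_map_end:
  "chain_map p (Pair t) (chain_map p f c) = chain_map p (map_prod id f) (chain_map p (Pair t) c)"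
proof -
  have "Pair t \<circ> f = map_prod id f \<circ> Pair t"
    by auto
  then show ?thesis
    using chain_map_compose by (metis comp_apply)
qed

text \<open>\<open>bd\<close> is the case of the fundamental chain. Each of its terms is natural, so
  pushing forward along \<open>map_prod id \<sigma>\<close> gives the case of a simplex
  \<open>\<sigma>\<close>, and additivity gives all chains.\<close>

lemma chain_boundary_prism_map:
  fixes c :: "'a chain"
  assumes Q: "singular_chain (Suc p) (cylinder (standard_simplex_space p)) Q"
    and Q': "p \<noteq> 0 \<Longrightarrow> singular_chain p (cylinder (standard_simplex_space (p - 1))) Q'"
    and bd: "chain_boundary (Suc p) Q
        = chain_map p (Pair 1) (fundamental_chain p) - chain_map p (Pair 0) (fundamental_chain p)
          - prism_map (p - 1) Q' (chain_boundary p (fundamental_chain p))"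
    and c: "singular_chain p X c"
  shows "chain_boundary (Suc p) (prism_map p Q c)
    = chain_map p (Pair 1) c - chain_map p (Pair 0) c - prism_map (p - 1) Q' (chain_boundary p c)"
  using c unfolding singular_chain_def
proof (induction c rule: frag_induction)
  case (one \<sigma>)
  then have \<sigma>: "singular_simplex p X \<sigma>"
    by simp
  let ?\<iota> = "fundamental_chain p" and ?\<Sigma> = "map_prod id \<sigma> :: real \<times> (nat \<Rightarrow> real) \<Rightarrow> real \<times> 'a"
  have \<iota>: "chain_map p \<sigma> ?\<iota> = frag_of \<sigma>"
    using chain_map_fundamental_chain[OF \<sigma>] .
  have "chain_map p ?\<Sigma> (prism_map (p - 1) Q' (chain_boundary p ?\<iota>))
      = prism_map (p - 1) Q' (chain_boundary p (frag_of \<sigma>))"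
  \<comment> \<open>In degree 0 the index \<open>p - 1\<close> is again 0, but
    \<open>chain_boundary 0\<close> is zero, so both sides vanish.\<close>
  proof (cases "p = 0")
    case True
    then show ?thesis by (simp add: chain_boundary_def)
  next
    case False
    then have "chain_map p ?\<Sigma> (prism_map (p - 1) Q' (chain_boundary p ?\<iota>))
      = prism_map (p - 1) Q' (chain_map (p - 1) \<sigma> (chain_boundary p ?\<iota>))"
      using prism_map_chain_map[of "p - 1" Q' \<sigma>] Q' by simp
    also have "chain_map (p - 1) \<sigma> (chain_boundary p ?\<iota>) = chain_boundary p (frag_of \<sigma>)"
      using chain_boundary_chain_map[OF singular_chain_fundamental_chain, of p \<sigma>] \<iota> by simp
    finally show ?thesis .
  qed
  moreover have "chain_map p ?\<Sigma> (chain_map p (Pair t) ?\<iota>) = chain_map p (Pair t) (frag_of \<sigma>)" for t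
    using chain_map_end[of p t \<sigma> ?\<iota>] \<iota> by simp
  moreover have "chain_boundary (Suc p) (prism_map p Q (frag_of \<sigma>))
      = chain_map p ?\<Sigma> (chain_boundary (Suc p) Q)"
    using chain_boundary_chain_map[OF Q] by (simp add: prism_map_of)
  ultimately show ?case
    by (simp add: bd chain_map_diff)
next
  case (diff a b)
  then show ?case
    by (simp add: prism_map_diff chain_boundary_diff chain_map_diff)
qed (simp add: prism_map_def)

text \<open>The start of the induction is separate because cycles of degree 0 need not bound. The
  two end points are homologous since the inclusions of the ends are homotopic.\<close>

lemma prism_base:
  "\<exists>Q. singular_chain 1 (cylinder (standard_simplex_space 0)) Q \<and>
     chain_boundary 1 Q
       = chain_map 0 (Pair 1) (fundamental_chain 0) - chain_map 0 (Pair 0) (fundamental_chain 0)"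
proof -
  let ?X = "standard_simplex_space 0"
  have "homotopic_with (\<lambda>h. True) ?X (cylinder ?X) (Pair 1) (Pair 0)"
    \<comment> \<open>After the swap, the homotopy from \<open>Pair 0\<close> to
      \<open>Pair 1\<close> is the identity of the cylinder.\<close>
    by (subst homotopic_with_sym, unfold homotopic_with_def)
      (intro exI[of _ id], auto)
  moreover have "singular_relcycle 0 ?X {} (fundamental_chain 0)"
    using singular_chain_fundamental_chain[of 0] by (simp add: singular_cycle chain_boundary_def)
  ultimately have "homologous_rel 0 (cylinder ?X) {}
      (chain_map 0 (Pair 1) (fundamental_chain 0)) (chain_map 0 (Pair 0) (fundamental_chain 0))"
    using homotopic_imp_homologous_rel_chain_maps[of "{}" "{}"] by simp
  then show ?thesis
    by (simp add: homologous_rel_def singular_boundary)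
qed

text \<open>The required boundary is a cycle by the equation one degree lower, hence it bounds in
  the contractible cylinder.\<close>

lemma prism_step:
  assumes Q: "singular_chain (Suc p) (cylinder (standard_simplex_space p)) Q"
    and Q': "p \<noteq> 0 \<Longrightarrow> singular_chain p (cylinder (standard_simplex_space (p - 1))) Q'"
    and bd: "chain_boundary (Suc p) Q
        = chain_map p (Pair 1) (fundamental_chain p) - chain_map p (Pair 0) (fundamental_chain p)
          - prism_map (p - 1) Q' (chain_boundary p (fundamental_chain p))"
  shows "\<exists>R. singular_chain (Suc (Suc p)) (cylinder (standard_simplex_space (Suc p))) R \<and>
     chain_boundary (Suc (Suc p)) R
       = chain_map (Suc p) (Pair 1) (fundamental_chain (Suc p))
         - chain_map (Suc p) (Pair 0) (fundamental_chain (Suc p))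
         - prism_map p Q (chain_boundary (Suc p) (fundamental_chain (Suc p)))"
    (is "\<exists>R. _ \<and> _ = ?Z")
proof -
  let ?X = "standard_simplex_space (Suc p)" and ?\<iota> = "fundamental_chain (Suc p)"
  note \<iota> = singular_chain_fundamental_chain[of "Suc p"]
  have bd_\<iota>: "singular_chain p ?X (chain_boundary (Suc p) ?\<iota>)"
    using singular_chain_boundary_alt[OF \<iota>] .
  have "singular_chain (Suc p) (cylinder ?X) ?Z"
    by (intro singular_chain_diff singular_chain_prism_map[OF Q bd_\<iota>]
        singular_chain_chain_map[OF \<iota>] continuous_map_end) auto
  \<comment> \<open>By the degree \<open>p\<close> equation on the boundary of
    \<open>?\<iota>\<close>, the prism term contributes the two ends of that boundary, which cancel;
    the rest contains the square of the boundary map and is 0.\<close>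
  moreover have "chain_boundary (Suc p) ?Z = 0"
    using chain_boundary_prism_map[OF Q Q' bd bd_\<iota>] chain_boundary_boundary_alt[OF \<iota>]
      chain_boundary_chain_map[OF \<iota>, of "Pair (0 :: real)"]
      chain_boundary_chain_map[OF \<iota>, of "Pair (1 :: real)"]
    by (simp add: chain_boundary_diff)
  ultimately have "singular_relcycle (Suc p) (cylinder ?X) {} ?Z"
    by (simp add: singular_cycle)
  then have "singular_relboundary (Suc p) (cylinder ?X) {} ?Z"
    by (intro contractible_space_cycle_imp_boundary contractible_cylinder
        contractible_standard_simplex_space) auto
  then show ?thesis
    by (simp add: singular_boundary)
qed

lemma prism_exists:
  obtains Q where "\<And>p. singular_chain (Suc p) (cylinder (standard_simplex_space p)) (Q p)"
    and "\<And>p. chain_boundary (Suc p) (Q p)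
        = chain_map p (Pair 1) (fundamental_chain p) - chain_map p (Pair 0) (fundamental_chain p)
          - prism_map (p - 1) (Q (p - 1)) (chain_boundary p (fundamental_chain p))"
proof -
  \<comment> \<open>\<open>R\<close> carries the prisms of two consecutive simplices, because the
    equation for \<open>Q\<close> refers to its predecessor \<open>Q'\<close>. Successive pairs are
    linked by \<open>fst (f (Suc p)) = snd (f p)\<close>.\<close>
  define good where "good p R \<longleftrightarrow> (case R of (Q', Q) \<Rightarrow>
      singular_chain (Suc p) (cylinder (standard_simplex_space p)) Q \<and>
      (p \<noteq> 0 \<longrightarrow> singular_chain p (cylinder (standard_simplex_space (p - 1))) Q') \<and>
      chain_boundary (Suc p) Q
        = chain_map p (Pair 1) (fundamental_chain p) - chain_map p (Pair 0) (fundamental_chain p)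
          - prism_map (p - 1) Q' (chain_boundary p (fundamental_chain p)))" for p R
  have "\<exists>f. \<forall>p. good p (f p) \<and> fst (f (Suc p)) = snd (f p)"
  proof (rule dependent_nat_choice)
    show "\<exists>R. good 0 R"
      using prism_base by (auto simp: good_def chain_boundary_def[of 0])
    show "\<exists>S. good (Suc p) S \<and> fst S = snd R" if "good p R" for p R
      using that prism_step[of p "snd R" "fst R"] by (auto simp: good_def case_prod_unfold)
  qed
  then obtain f where f: "\<And>p. good p (f p)" "\<And>p. fst (f (Suc p)) = snd (f p)"
    by blast
  \<comment> \<open>At \<open>p = 0\<close> the index \<open>p - 1\<close> does not name a
    predecessor, but the prism is then taken of the zero boundary.\<close>
  have "chain_boundary (Suc p) (snd (f p))
        = chain_map p (Pair 1) (fundamental_chain p) - chain_map p (Pair 0) (fundamental_chain p)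
          - prism_map (p - 1) (snd (f (p - 1))) (chain_boundary p (fundamental_chain p))" for p
    using f(1)[of p] f(2)[of "p - 1"]
    by (cases p) (auto simp: good_def case_prod_unfold chain_boundary_def[of 0])
  then show ?thesis
    using that[of "\<lambda>p. snd (f p)"] f(1) by (auto simp: good_def case_prod_unfold)
qed

text \<open>\<open>K\<close> pushes the natural prism forward along the homotopy. Additivity on all
  chains lets cochains be composed with it, and \<open>K p 0 = 0\<close> settles degree 0, where
  \<open>p - 1\<close> is again 0. Arbitrary \<open>P\<close> covers based homotopies.\<close>

proposition homotopic_imp_chain_homotopic:
  assumes "homotopic_with P X Y f g"
  obtains K where "\<And>p. K p 0 = 0"
    and "\<And>p c d. K p (c + d) = K p c + K p d"
    and "\<And>p c. singular_chain p X c \<Longrightarrow> singular_chain (Suc p) Y (K p c)"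
    and "\<And>p c. singular_chain p X c \<Longrightarrow>
       chain_boundary (Suc p) (K p c) = chain_map p g c - chain_map p f c - K (p - 1) (chain_boundary p c)"
proof -
  obtain h where h: "continuous_map (cylinder X) Y h" "\<And>x. h (0, x) = f x" "\<And>x. h (1, x) = g x"
    using assms by (auto simp: homotopic_with_def)
  obtain Q where Q: "\<And>p. singular_chain (Suc p) (cylinder (standard_simplex_space p)) (Q p)"
    and bd: "\<And>p. chain_boundary (Suc p) (Q p)
        = chain_map p (Pair 1) (fundamental_chain p) - chain_map p (Pair 0) (fundamental_chain p)
          - prism_map (p - 1) (Q (p - 1)) (chain_boundary p (fundamental_chain p))"
    using prism_exists by blast
  define K where "K p c = chain_map (Suc p) h (prism_map p (Q p) c)" for p c
  have "chain_boundary (Suc p) (K p c) = chain_map p g c - chain_map p f c - K (p - 1) (chain_boundary p c)"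
    if c: "singular_chain p X c" for p c
  proof -
    have Q': "singular_chain p (cylinder (standard_simplex_space (p - 1))) (Q (p - 1))" if "p \<noteq> 0"
      using Q[of "p - 1"] that by simp
    have "h \<circ> Pair 0 = f" "h \<circ> Pair 1 = g"
      using h by auto
    then have ends: "chain_map p h (chain_map p (Pair 0) c) = chain_map p f c"
        "chain_map p h (chain_map p (Pair 1) c) = chain_map p g c"
      using chain_map_compose by (metis comp_apply)+
    have "chain_map p h (prism_map (p - 1) (Q (p - 1)) (chain_boundary p c)) = K (p - 1) (chain_boundary p c)"
      by (cases p) (auto simp: K_def chain_boundary_def)
    then show ?thesis
      using chain_boundary_chain_map[OF singular_chain_prism_map[OF Q c], of h]
        chain_boundary_prism_map[OF Q Q' bd c] ends
      by (simp add: K_def chain_map_diff)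
  qed
  moreover have "singular_chain (Suc p) Y (K p c)" if "singular_chain p X c" for p c
    unfolding K_def using singular_chain_chain_map[OF singular_chain_prism_map[OF Q that] h(1)] .
  ultimately show ?thesis
    using that[of K] by (simp add: K_def prism_map_add chain_map_add)
qed


section \<open>Homotopy invariance of cohomology\<close>

lemma carrier_cohomology_group:
  "carrier (cohomology_group p X)
     = (\<lambda>b. coboundary_set p X #>\<^bsub>cocycle_group p X\<^esub> b) ` carrier (cocycle_group p X)"
  by (auto simp: cohomology_group_def carrier_FactGroup)

lemma cohom_induced_hom:
  assumes f: "continuous_map X Y f"
  shows "cohom_induced p X Y f \<in> hom (cohomology_group p Y) (cohomology_group p X)"
proof (rule homI)
  let ?X = "cocycle_group p X" and ?Y = "cocycle_group p Y"
  let ?BX = "coboundary_set p X" and ?BY = "coboundary_set p Y"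
  interpret X: comm_group ?X by (rule comm_group_cocycle_group)
  interpret Y: comm_group ?Y by (rule comm_group_cocycle_group)
  interpret BX: normal ?BX ?X
    using X.subgroup_imp_normal[OF subgroup_coboundary_set] .
  interpret BY: normal ?BY ?Y
    using Y.subgroup_imp_normal[OF subgroup_coboundary_set] .
  note hom = cochain_map_cocycle[OF f, of p]
  show "cohom_induced p X Y f K \<in> carrier (cohomology_group p X)"
    if "K \<in> carrier (cohomology_group p Y)" for K
    using that cohom_induced_coset[OF f] hom_in_carrier[OF hom]
    by (auto simp: carrier_cohomology_group)
  show "cohom_induced p X Y f (K \<otimes>\<^bsub>cohomology_group p Y\<^esub> L)
      = cohom_induced p X Y f K \<otimes>\<^bsub>cohomology_group p X\<^esub> cohom_induced p X Y f L"
    if KL: "K \<in> carrier (cohomology_group p Y)" "L \<in> carrier (cohomology_group p Y)" for K L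
  proof -
    obtain a b where ab: "a \<in> carrier ?Y" "b \<in> carrier ?Y" "K = ?BY #>\<^bsub>?Y\<^esub> a" "L = ?BY #>\<^bsub>?Y\<^esub> b"
      using KL by (auto simp: carrier_cohomology_group)
    then show ?thesis
      using cohom_induced_coset[OF f] hom_in_carrier[OF hom] hom_mult[OF hom]
      by (simp add: cohomology_group_def FactGroup_def BX.rcos_sum BY.rcos_sum)
  qed
qed

lemma cohom_induced_compose:
  assumes f: "continuous_map X Y f" and g: "continuous_map Y Z g"
    and K: "K \<in> carrier (cohomology_group p Z)"
  shows "cohom_induced p X Z (g \<circ> f) K = cohom_induced p X Y f (cohom_induced p Y Z g K)"
proof -
  obtain b where b: "b \<in> carrier (cocycle_group p Z)"
      "K = coboundary_set p Z #>\<^bsub>cocycle_group p Z\<^esub> b"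
    using K by (auto simp: carrier_cohomology_group)
  have "cochain_map p X (g \<circ> f) b = cochain_map p X f (cochain_map p Y g b)"
    using singular_chain_chain_map[OF _ f]
    by (auto simp: cochain_map_def chain_map_compose intro!: restrict_ext)
  then show ?thesis
    using b cohom_induced_coset[OF f] cohom_induced_coset[OF g]
      cohom_induced_coset[OF continuous_map_compose[OF f g]]
      hom_in_carrier[OF cochain_map_cocycle[OF g]]
    by simp
qed

lemma cohom_induced_id:
  assumes K: "K \<in> carrier (cohomology_group p X)"
  shows "cohom_induced p X X id K = K"
proof -
  obtain b where b: "b \<in> carrier (cocycle_group p X)"
      "K = coboundary_set p X #>\<^bsub>cocycle_group p X\<^esub> b"
    using K by (auto simp: carrier_cohomology_group)
  \<comment> \<open>\<open>cochain_map\<close> restricts its result to singular chains, so it fixes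
    \<open>b\<close> only because cochains are extensional.\<close>
  then have "b \<in> extensional (singular_chain_set p X)"
    by (simp add: carrier_cocycle_group cocycle_set_def kernel_def carrier_cochain_group)
  then have "cochain_map p X id b = b"
    by (auto simp: cochain_map_def chain_map_ident extensional_def)
  then show ?thesis
    using b cohom_induced_coset[OF continuous_map_id] by metis
qed

text \<open>Evaluate \<open>b\<close> on the chain homotopy equation: the boundary of
  \<open>K p c\<close> contributes 0 because \<open>b\<close> is a cocycle, and what remains beside
  the pullback along \<open>f\<close> is, in positive degree, the coboundary of \<open>b\<close>
  composed with \<open>K\<close>.\<close>

lemma cochain_map_homotopic:
  assumes hom: "homotopic_with P X Y f g" and b: "b \<in> cocycle_set p Y"
  shows "\<exists>h\<in>coboundary_set p X.
    cochain_map p X g b = h \<otimes>\<^bsub>cochain_group p X\<^esub> cochain_map p X f b"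
proof -
  obtain K where K: "\<And>p. K p 0 = 0" "\<And>p c d. K p (c + d) = K p c + K p d"
      "\<And>p c. singular_chain p X c \<Longrightarrow> singular_chain (Suc p) Y (K p c)"
      "\<And>p c. singular_chain p X c \<Longrightarrow>
       chain_boundary (Suc p) (K p c) = chain_map p g c - chain_map p f c - K (p - 1) (chain_boundary p c)"
    using homotopic_imp_chain_homotopic[OF hom] by blast
  have f: "continuous_map X Y f" and g: "continuous_map X Y g"
    using homotopic_with_imp_continuous_maps[OF hom] by auto
  have add: "b (c + d) = b c + b d" if "singular_chain p Y c" "singular_chain p Y d" for c d
    using b that by (simp add: cocycle_set_def kernel_def carrier_cochain_group)
  have cocycle: "b (chain_boundary (Suc p) c) = 0" if "singular_chain (Suc p) Y c" for c
  proof -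
    have "coboundary p Y b = \<one>\<^bsub>cochain_group (Suc p) Y\<^esub>"
      using b by (simp add: cocycle_set_def kernel_def)
    then have "coboundary p Y b c = \<one>\<^bsub>cochain_group (Suc p) Y\<^esub> c"
      by simp
    then show ?thesis
      using that by (simp add: coboundary_def one_cochain_group)
  qed
  have eq: "b (chain_map p g c) = b (K (p - 1) (chain_boundary p c)) + b (chain_map p f c)"
    if c: "singular_chain p X c" for c
  proof -
    have chains: "singular_chain p Y (chain_boundary (Suc p) (K p c))"
        "singular_chain p Y (K (p - 1) (chain_boundary p c))"
        "singular_chain p Y (chain_map p f c)"
      subgoal using singular_chain_boundary_alt K(3)[OF c] by blast
      subgoal
        using K(1) K(3)[of "p - 1"] singular_chain_boundary[OF c]
        by (cases p) (auto simp: chain_boundary_def)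
      subgoal using singular_chain_chain_map[OF c f] .
      done
    \<comment> \<open>Rearranged without minus signs, since \<open>add\<close> handles sums.\<close>
    have "chain_map p g c = chain_boundary (Suc p) (K p c)
        + (K (p - 1) (chain_boundary p c) + chain_map p f c)"
      using K(4)[OF c] by simp
    then show ?thesis
      using add chains cocycle[OF K(3)[OF c]] by (simp add: singular_chain_add)
  qed
  show ?thesis
  proof (cases p)
    case 0
    \<comment> \<open>In degree 0 \<open>coboundary_set\<close> contains only the zero cochain, so
      the correction term \<open>b (K 0 0)\<close> has to vanish.\<close>
    have "b (K 0 0) = 0"
      using add[of 0 0] K(1) by simp
    then have "cochain_map p X g b
        = \<one>\<^bsub>cochain_group 0 X\<^esub> \<otimes>\<^bsub>cochain_group p X\<^esub> cochain_map p X f b"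
      using eq 0
      by (auto simp: cochain_map_def mult_cochain_group one_cochain_group chain_boundary_def
          intro!: restrict_ext)
    then show ?thesis
      by (simp add: coboundary_set_def 0)
  next
    case (Suc q)
    \<comment> \<open>The coboundary of \<open>a\<close> sends \<open>c\<close> to
      \<open>b (K q (chain_boundary p c))\<close>, the correction term in \<open>eq\<close>.\<close>
    define a where "a = (\<lambda>c\<in>singular_chain_set q X. b (K q c))"
    have a: "a \<in> carrier (cochain_group q X)"
      using add K(2,3) Suc by (auto simp: a_def carrier_cochain_group singular_chain_add)
    have "cochain_map p X g b = coboundary q X a \<otimes>\<^bsub>cochain_group p X\<^esub> cochain_map p X f b"
      using eq Suc singular_chain_boundary_alt[of q X]
      by (auto simp: cochain_map_def mult_cochain_group coboundary_def a_def intro!: restrict_ext)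
    then show ?thesis
      using a by (auto simp: coboundary_set_def Suc)
  qed
qed

text \<open>Pullbacks of a cocycle along \<open>f\<close> and \<open>g\<close> differ by a
  coboundary and hence give the same coset. Equality of functions also uses that both are
  \<open>undefined\<close> off the carrier.\<close>

lemma cohom_induced_homotopic:
  assumes hom: "homotopic_with P X Y f g"
  shows "cohom_induced p X Y f = cohom_induced p X Y g"
proof
  fix K
  let ?X = "cocycle_group p X" and ?Y = "cocycle_group p Y" and ?B = "coboundary_set p X"
  interpret X: comm_group ?X by (rule comm_group_cocycle_group)
  have f: "continuous_map X Y f" and g: "continuous_map X Y g"
    using homotopic_with_imp_continuous_maps[OF hom] by auto
  show "cohom_induced p X Y f K = cohom_induced p X Y g K"
  proof (cases "K \<in> carrier (cohomology_group p Y)")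
    case True
    then obtain b where b: "b \<in> carrier ?Y" "K = coboundary_set p Y #>\<^bsub>?Y\<^esub> b"
      by (auto simp: carrier_cohomology_group)
    have "cochain_map p X g b \<in> ?B #>\<^bsub>?X\<^esub> cochain_map p X f b"
      using cochain_map_homotopic[OF hom, of b p] b(1)
      by (auto simp: r_coset_def carrier_cocycle_group) (auto simp: cocycle_group_def)
    then have "?B #>\<^bsub>?X\<^esub> cochain_map p X f b = ?B #>\<^bsub>?X\<^esub> cochain_map p X g b"
      using X.repr_independence[OF _ _ subgroup_coboundary_set]
        hom_in_carrier[OF cochain_map_cocycle[OF f] b(1)] by metis
    then show ?thesis
      using b cohom_induced_coset[OF f] cohom_induced_coset[OF g] by simp
  next
    case False
    then show ?thesis by (simp add: cohom_induced_def)
  qed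
qed

lemma cohom_induced_compose_iso:
  assumes f: "continuous_map X Y f" "cohom_induced p X Y f \<in> iso (cohomology_group p Y) (cohomology_group p X)"
    and g: "continuous_map Y Z g" "cohom_induced p Y Z g \<in> iso (cohomology_group p Z) (cohomology_group p Y)"
  shows "cohom_induced p X Z (g \<circ> f) \<in> iso (cohomology_group p Z) (cohomology_group p X)"
proof -
  have "bij_betw (cohom_induced p X Y f \<circ> cohom_induced p Y Z g)
      (carrier (cohomology_group p Z)) (carrier (cohomology_group p X))"
    using iso_set_trans[OF g(2) f(2)] by (simp add: iso_def)
  \<comment> \<open>The composition law is available only on the carrier, so bijectivity passes
    through \<open>bij_betw_cong\<close> and not through an equality of functions.\<close>
  then have "bij_betw (cohom_induced p X Z (g \<circ> f))
      (carrier (cohomology_group p Z)) (carrier (cohomology_group p X))"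
    by (rule bij_betw_cong[THEN iffD1, rotated]) (simp add: cohom_induced_compose[OF f(1) g(1)])
  then show ?thesis
    using cohom_induced_hom[OF continuous_map_compose[OF f(1) g(1)]] by (simp add: iso_def)
qed

text \<open>Functoriality and homotopy invariance make the map induced by \<open>g\<close> a
  two-sided inverse.\<close>

lemma homotopy_equivalence_cohom_iso:
  assumes f: "continuous_map X Y f" and g: "continuous_map Y X g"
    and gf: "homotopic_with P X X (g \<circ> f) id" and fg: "homotopic_with Q Y Y (f \<circ> g) id"
  shows "cohom_induced p X Y f \<in> iso (cohomology_group p Y) (cohomology_group p X)"
proof -
  have "cohom_induced p Y X g (cohom_induced p X Y f K) = K"
    if "K \<in> carrier (cohomology_group p Y)" for K
    using cohom_induced_compose[OF g f that] cohom_induced_homotopic[OF fg] cohom_induced_id[OF that]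
    by metis
  moreover have "cohom_induced p X Y f (cohom_induced p Y X g K) = K"
    if "K \<in> carrier (cohomology_group p X)" for K
    using cohom_induced_compose[OF f g that] cohom_induced_homotopic[OF gf] cohom_induced_id[OF that]
    by metis
  ultimately have "group_isomorphisms (cohomology_group p Y) (cohomology_group p X)
      (cohom_induced p X Y f) (cohom_induced p Y X g)"
    using cohom_induced_hom[OF f] cohom_induced_hom[OF g] by (simp add: group_isomorphisms_def)
  then show ?thesis
    by (rule group_isomorphisms_imp_iso)
qed


section \<open>Transport of self-maps along an equivalence\<close>

lemma based_map_compose:
  "based_map X x Y y f \<Longrightarrow> based_map Y y Z z g \<Longrightarrow> based_map X x Z z (g \<circ> f)"
  by (auto simp: based_map_def continuous_map_compose)

lemma based_homotopic_sym:
  "based_homotopic X x Y y f g \<Longrightarrow> based_homotopic X x Y y g f"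
  unfolding based_homotopic_def by (rule homotopic_with_symD)

lemma based_homotopic_trans:
  "based_homotopic X x Y y f g \<Longrightarrow> based_homotopic X x Y y g h \<Longrightarrow> based_homotopic X x Y y f h"
  unfolding based_homotopic_def by (rule homotopic_with_trans)

lemma based_homotopic_refl: "based_map X x Y y f \<Longrightarrow> based_homotopic X x Y y f f"
  by (simp add: based_homotopic_def based_map_def)

lemma based_homotopic_compose_left:
  "based_homotopic X x Y y f g \<Longrightarrow> based_map Y y Z z h \<Longrightarrow> based_homotopic X x Z z (h \<circ> f) (h \<circ> g)"
  unfolding based_homotopic_def based_map_def
  by (erule homotopic_with_compose_continuous_map_left) auto

lemma based_homotopic_compose_right:
  "based_homotopic Y y Z z f g \<Longrightarrow> based_map X x Y y h \<Longrightarrow> based_homotopic X x Z z (f \<circ> h) (g \<circ> h)"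
  unfolding based_homotopic_def based_map_def
  by (erule homotopic_with_compose_continuous_map_right) auto

text \<open>A map that is not based has an empty class, so equal classes yield a homotopy only when
  one map is known to be based.\<close>

lemma based_class_eq_iff:
  assumes "based_map X x Y y f"
  shows "based_class X x Y y f = based_class X x Y y g \<longleftrightarrow> based_homotopic X x Y y f g"
proof
  assume "based_class X x Y y f = based_class X x Y y g"
  then have "based_homotopic X x Y y g f"
    using based_homotopic_refl[OF assms] by (auto simp: based_class_def)
  then show "based_homotopic X x Y y f g" by (rule based_homotopic_sym)
next
  assume "based_homotopic X x Y y f g"
  then show "based_class X x Y y f = based_class X x Y y g"
    unfolding based_class_def
    by (intro Collect_cong) (metis based_homotopic_sym based_homotopic_trans)
qed

text \<open>Conjugating \<open>g\<close> there and back gives \<open>\<phi> \<circ> \<psi> \<circ> g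
  \<circ> \<phi> \<circ> \<psi>\<close>, where both copies of \<open>\<phi> \<circ> \<psi>\<close>
  cancel up to homotopy; \<open>f\<close> may then replace the inner conjugate.\<close>

lemma based_homotopic_conjugate:
  assumes \<phi>: "based_map X x Y y \<phi>" and \<psi>: "based_map Y y X x \<psi>"
    and \<phi>\<psi>: "based_homotopic Y y Y y (\<phi> \<circ> \<psi>) id"
    and g: "based_map Y y Y y g" and f: "based_homotopic X x X x (\<psi> \<circ> g \<circ> \<phi>) f"
  shows "based_homotopic Y y Y y g (\<phi> \<circ> f \<circ> \<psi>)"
proof -
  have "based_homotopic Y y Y y (\<phi> \<circ> (\<psi> \<circ> g \<circ> \<phi>) \<circ> \<psi>) (\<phi> \<circ> \<psi> \<circ> g)"
    using based_homotopic_compose_left[OF \<phi>\<psi> based_map_compose[OF based_map_compose[OF g \<psi>] \<phi>]]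
    by (simp add: comp_assoc)
  moreover have "based_homotopic Y y Y y (\<phi> \<circ> \<psi> \<circ> g) g"
    using based_homotopic_compose_right[OF \<phi>\<psi> g] by simp
  ultimately have "based_homotopic Y y Y y g (\<phi> \<circ> (\<psi> \<circ> g \<circ> \<phi>) \<circ> \<psi>)"
    by (rule based_homotopic_sym[OF based_homotopic_trans])
  moreover have "based_homotopic Y y Y y (\<phi> \<circ> (\<psi> \<circ> g \<circ> \<phi>) \<circ> \<psi>) (\<phi> \<circ> f \<circ> \<psi>)"
    using based_homotopic_compose_right[OF based_homotopic_compose_left[OF f \<phi>] \<psi>] .
  ultimately show ?thesis
    by (rule based_homotopic_trans)
qed

text \<open>The sets of maps are arbitrary, so that one argument gives both inclusions between
  self-equivalences and isomorphism classes, for homology and cohomology. A class goes to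
  \<open>X\<close> by conjugation, finds a representative in \<open>Q\<close>, and comes
  back.\<close>

lemma conjugate_classes_subset:
  assumes \<phi>: "based_map X x Y y \<phi>" and \<psi>: "based_map Y y X x \<psi>"
    and \<phi>\<psi>: "based_homotopic Y y Y y (\<phi> \<circ> \<psi>) id"
    and P: "\<And>g. g \<in> P' \<Longrightarrow> based_map Y y Y y g \<and> \<psi> \<circ> g \<circ> \<phi> \<in> P"
    and Q: "\<And>f. f \<in> Q \<Longrightarrow> \<phi> \<circ> f \<circ> \<psi> \<in> Q'"
    and sub: "based_class X x X x ` P \<subseteq> based_class X x X x ` Q"
  shows "based_class Y y Y y ` P' \<subseteq> based_class Y y Y y ` Q'"
proof (rule image_subsetI)
  fix g assume g: "g \<in> P'"
  then have map: "based_map X x X x (\<psi> \<circ> g \<circ> \<phi>)"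
    using P \<phi> \<psi> based_map_compose by metis
  obtain f where f: "f \<in> Q" "based_class X x X x (\<psi> \<circ> g \<circ> \<phi>) = based_class X x X x f"
    using P[OF g] sub by blast
  then have "based_homotopic Y y Y y g (\<phi> \<circ> f \<circ> \<psi>)"
    using based_homotopic_conjugate[OF \<phi> \<psi> \<phi>\<psi>] P[OF g] based_class_eq_iff[OF map] by blast
  then have "based_class Y y Y y g = based_class Y y Y y (\<phi> \<circ> f \<circ> \<psi>)"
    by (simp only: based_class_eq_iff[OF P[OF g, THEN conjunct1]])
  then show "based_class Y y Y y g \<in> based_class Y y Y y ` Q'"
    using Q[OF f(1)] by simp
qed

section \<open>Based equivalences and the isomorphisms they induce\<close>

lemma based_homotopy_equivalence_compose:
  assumes "based_homotopy_equivalence X x Y y f" "based_homotopy_equivalence Y y Z z g"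
  shows "based_homotopy_equivalence X x Z z (g \<circ> f)"
proof -
  obtain f' g' where f: "based_map X x Y y f" "based_map Y y X x f'"
      "based_homotopic X x X x (f' \<circ> f) id" "based_homotopic Y y Y y (f \<circ> f') id"
    and g: "based_map Y y Z z g" "based_map Z z Y y g'"
      "based_homotopic Y y Y y (g' \<circ> g) id" "based_homotopic Z z Z z (g \<circ> g') id"
    using assms unfolding based_homotopy_equivalence_def by blast
  have "based_homotopic X x X x (f' \<circ> (g' \<circ> g) \<circ> f) (f' \<circ> id \<circ> f)"
    by (intro based_homotopic_compose_right[OF based_homotopic_compose_left[OF g(3) f(2)]] f)
  then have "based_homotopic X x X x (f' \<circ> g' \<circ> (g \<circ> f)) (f' \<circ> f)"
    by (simp add: comp_assoc)
  then have "based_homotopic X x X x (f' \<circ> g' \<circ> (g \<circ> f)) id"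
    using f(3) by (rule based_homotopic_trans)
  moreover
  have "based_homotopic Z z Z z (g \<circ> (f \<circ> f') \<circ> g') (g \<circ> id \<circ> g')"
    by (intro based_homotopic_compose_right[OF based_homotopic_compose_left[OF f(4) g(1)]] g)
  then have "based_homotopic Z z Z z (g \<circ> f \<circ> (f' \<circ> g')) (g \<circ> g')"
    by (simp add: comp_assoc)
  then have "based_homotopic Z z Z z (g \<circ> f \<circ> (f' \<circ> g')) id"
    using g(4) by (rule based_homotopic_trans)
  ultimately show ?thesis
    unfolding based_homotopy_equivalence_def
    using based_map_compose[OF f(1) g(1)] based_map_compose[OF g(2) f(2)] by blast
qed

lemma based_homotopy_equivalence_homology_iso:
  assumes "based_homotopy_equivalence X x Y y f"
  shows "hom_induced p X {} Y {} f \<in> iso (homology_group p X) (homology_group p Y)"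
proof -
  obtain g where "continuous_map X Y f" "continuous_map Y X g"
      "based_homotopic X x X x (g \<circ> f) id" "based_homotopic Y y Y y (f \<circ> g) id"
    using assms by (auto simp: based_homotopy_equivalence_def based_map_def)
  then show ?thesis
    unfolding based_homotopic_def
    by (intro homotopy_equivalence_homology_group_isomorphism[of X Y f g])
       (auto elim: homotopic_with_mono)
qed

lemma based_homotopy_equivalence_cohomology_iso:
  assumes "based_homotopy_equivalence X x Y y f"
  shows "cohom_induced p X Y f \<in> iso (cohomology_group p Y) (cohomology_group p X)"
proof -
  obtain g where "continuous_map X Y f" "continuous_map Y X g"
      "based_homotopic X x X x (g \<circ> f) id" "based_homotopic Y y Y y (f \<circ> g) id"
    using assms by (auto simp: based_homotopy_equivalence_def based_map_def)
  then show ?thesis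
    unfolding based_homotopic_def by (rule homotopy_equivalence_cohom_iso)
qed

text \<open>By functoriality, conjugation composes the isomorphism induced by \<open>f\<close> with
  those induced by \<open>\<phi>\<close> and \<open>\<psi>\<close>.\<close>

lemma iso_classes_conjugate:
  assumes \<phi>: "based_homotopy_equivalence X x Y y \<phi>" and \<psi>: "based_homotopy_equivalence Y y X x \<psi>"
    and f: "based_map X x X x f"
  shows "hom_induced p X {} X {} f \<in> iso (homology_group p X) (homology_group p X) \<Longrightarrow>
      hom_induced p Y {} Y {} (\<phi> \<circ> f \<circ> \<psi>) \<in> iso (homology_group p Y) (homology_group p Y)"
    and "cohom_induced i X X f \<in> iso (cohomology_group i X) (cohomology_group i X) \<Longrightarrow>
      cohom_induced i Y Y (\<phi> \<circ> f \<circ> \<psi>) \<in> iso (cohomology_group i Y) (cohomology_group i Y)"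
proof -
  have cont: "continuous_map X Y \<phi>" "continuous_map Y X \<psi>" "continuous_map X X f"
    using \<phi> \<psi> f by (auto simp: based_homotopy_equivalence_def based_map_def)
  then have cont': "continuous_map X Y (\<phi> \<circ> f)"
    using continuous_map_compose by blast
  show "hom_induced p Y {} Y {} (\<phi> \<circ> f \<circ> \<psi>) \<in> iso (homology_group p Y) (homology_group p Y)"
    if "hom_induced p X {} X {} f \<in> iso (homology_group p X) (homology_group p X)"
    unfolding hom_induced_compose_empty[OF cont(2) cont'] hom_induced_compose_empty[OF cont(3,1)]
    using that \<phi> \<psi> based_homotopy_equivalence_homology_iso iso_set_trans by metis
  show "cohom_induced i Y Y (\<phi> \<circ> f \<circ> \<psi>) \<in> iso (cohomology_group i Y) (cohomology_group i Y)"
    if "cohom_induced i X X f \<in> iso (cohomology_group i X) (cohomology_group i X)"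
    by (rule cohom_induced_compose_iso[OF cont(2)
          based_homotopy_equivalence_cohomology_iso[OF \<psi>] cont'
          cohom_induced_compose_iso[OF cont(3) that cont(1)
            based_homotopy_equivalence_cohomology_iso[OF \<phi>]]])
qed

text \<open>For a fixed \<open>k\<close>, each of the two inclusions is carried over by conjugation.
  One direction suffices since \<open>X\<close> and \<open>Y\<close> may be exchanged.\<close>

lemma iso_classes_eq_self_equivalences_transfer:
  assumes "same_based_homotopy_type X x Y y"
  shows "homology_iso_classes k X x = self_equivalences X x \<Longrightarrow>
      homology_iso_classes k Y y = self_equivalences Y y"
    and "cohomology_iso_classes k X x = self_equivalences X x \<Longrightarrow>
      cohomology_iso_classes k Y y = self_equivalences Y y"
proof -
  obtain \<phi> \<psi> where \<phi>: "based_map X x Y y \<phi>" and \<psi>: "based_map Y y X x \<psi>"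
    and \<psi>\<phi>: "based_homotopic X x X x (\<psi> \<circ> \<phi>) id" and \<phi>\<psi>: "based_homotopic Y y Y y (\<phi> \<circ> \<psi>) id"
    using assms by (auto simp: same_based_homotopy_type_def based_homotopy_equivalence_def)
  have equiv: "based_homotopy_equivalence X x Y y \<phi>" "based_homotopy_equivalence Y y X x \<psi>"
    unfolding based_homotopy_equivalence_def
    by (intro conjI exI[of _ \<psi>] exI[of _ \<phi>] \<phi> \<psi> \<psi>\<phi> \<phi>\<psi>)+
  have map: "based_map Y y Y y (\<phi> \<circ> f \<circ> \<psi>)" if "based_map X x X x f" for f
    using based_map_compose[OF \<psi> based_map_compose[OF that \<phi>]] .
  have map': "based_map X x X x (\<psi> \<circ> g \<circ> \<phi>)" if "based_map Y y Y y g" for g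
    using based_map_compose[OF \<phi> based_map_compose[OF that \<psi>]] .
  have self: "based_homotopy_equivalence Y y Y y (\<phi> \<circ> f \<circ> \<psi>)"
    if "based_homotopy_equivalence X x X x f" for f
    by (intro based_homotopy_equivalence_compose[OF equiv(2)]
        based_homotopy_equivalence_compose[OF that equiv(1)])
  have self': "based_map Y y Y y g \<and> based_homotopy_equivalence X x X x (\<psi> \<circ> g \<circ> \<phi>)"
    if g: "based_homotopy_equivalence Y y Y y g" for g
  proof
    show "based_map Y y Y y g"
      using g by (simp add: based_homotopy_equivalence_def)
    show "based_homotopy_equivalence X x X x (\<psi> \<circ> g \<circ> \<phi>)"
      by (intro based_homotopy_equivalence_compose[OF equiv(1)]
          based_homotopy_equivalence_compose[OF g equiv(2)])
  qed
  note transfer = conjugate_classes_subset[OF \<phi> \<psi> \<phi>\<psi>]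
  note to_Y = iso_classes_conjugate[OF equiv] and to_X = iso_classes_conjugate[OF equiv(2,1)]
  show "homology_iso_classes k Y y = self_equivalences Y y"
    if eq: "homology_iso_classes k X x = self_equivalences X x"
  proof
    note defs = homology_iso_classes_def self_equivalences_def
    \<comment> \<open>Here \<open>P\<close> and \<open>P'\<close> consist of the maps inducing
      isomorphisms, \<open>Q\<close> and \<open>Q'\<close> of the equivalences; the opposite
      inclusion swaps these roles.\<close>
    show "homology_iso_classes k Y y \<subseteq> self_equivalences Y y"
      unfolding defs
      by (rule transfer[OF _ _ equalityD1[OF eq[unfolded defs]]]) (simp_all add: map' self to_X(1))
    show "self_equivalences Y y \<subseteq> homology_iso_classes k Y y"
      unfolding defs
      by (rule transfer[OF _ _ equalityD2[OF eq[unfolded defs]]]) (simp_all add: map self' to_Y(1))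
  qed
  show "cohomology_iso_classes k Y y = self_equivalences Y y"
    if eq: "cohomology_iso_classes k X x = self_equivalences X x"
  proof
    note defs = cohomology_iso_classes_def self_equivalences_def
    show "cohomology_iso_classes k Y y \<subseteq> self_equivalences Y y"
      unfolding defs
      by (rule transfer[OF _ _ equalityD1[OF eq[unfolded defs]]]) (simp_all add: map' self to_X(2))
    show "self_equivalences Y y \<subseteq> cohomology_iso_classes k Y y"
      unfolding defs
      by (rule transfer[OF _ _ equalityD2[OF eq[unfolded defs]]]) (simp_all add: map self' to_Y(2))
  qed
qed

lemma same_based_homotopy_type_sym:
  "same_based_homotopy_type X x Y y \<Longrightarrow> same_based_homotopy_type Y y X x"
  unfolding same_based_homotopy_type_def based_homotopy_equivalence_def by blast

theorem proposition37:
  fixes X :: "'a topology" and x :: 'a and Y :: "'b topology" and y :: 'b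
  assumes "x \<in> topspace X" and "y \<in> topspace Y"
    and "same_based_homotopy_type X x Y y"
  shows "homology_self_closeness X x = homology_self_closeness Y y \<and>
         cohomology_self_closeness X x = cohomology_self_closeness Y y"
proof -
  note transfer = iso_classes_eq_self_equivalences_transfer[OF assms(3)]
    iso_classes_eq_self_equivalences_transfer[OF same_based_homotopy_type_sym[OF assms(3)]]
  \<comment> \<open>The defining predicates agree for every \<open>k\<close>, so the least values
    agree, and so does the case \<open>None\<close>.\<close>
  have "(\<lambda>k. homology_iso_classes k X x = self_equivalences X x)
      = (\<lambda>k. homology_iso_classes k Y y = self_equivalences Y y)"
    "(\<lambda>k. cohomology_iso_classes k X x = self_equivalences X x)
      = (\<lambda>k. cohomology_iso_classes k Y y = self_equivalences Y y)"
    using transfer by (intro ext iffI; simp)+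
  then show ?thesis
    by (simp add: homology_self_closeness_def cohomology_self_closeness_def)
qed

end
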